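(* Fix $C>0$. For $n\geq 1$ let $N=2^n$ and let $A$ be a random subset of $\mathbb{F}_2^n$ obtained by including each element independently with probability $\frac12$. Then there exists $\epsilon>0$ such that, with probability bounded away from $0$ (i.e.\ at least some $\delta>0$ independent of $n$, for all sufficiently large $n$), there exists a subset $X\subset\mathbb{F}_2^n$ with $|X|\geq C\log N\log\log N$ such that $$\#\{(x_1,x_2)\in X\times X : x_1+x_2\in A\} \geq \left(\tfrac12+\epsilon\right)|X|^2.$$
   Context: $\log$ denotes the natural logarithm. *)

theory Defs
  imports "HOL-Probability.Probability" "HOL-Library.Z2" "Jordan_Normal_Form.Matrix"
begin

(* bit is the two-element field. The dimension n varies inside the statement, hence a carrier set
   instead of a type indexed by its dimension; Matrix.vec is qualified since HOL-Analysis has a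
   type of the same name. *)
abbreviation F2_space :: "nat \<Rightarrow> bit Matrix.vec set" where
  "F2_space n \<equiv> carrier_vec n"

(* S is meant to be finite; Pi_pmf draws the membership indicators of the elements of S
   independently. *)
definition random_subset :: "'a set \<Rightarrow> real \<Rightarrow> 'a set pmf" where
  "random_subset S p = map_pmf (\<lambda>b. {x \<in> S. b x}) (Pi_pmf S False (\<lambda>_. bernoulli_pmf p))"

end

theory Submission
  imports Defs "HOL-Real_Asymp.Real_Asymp"
begin

text \<open>
  Take for \<open>X\<close> a subspace \<open>V\<close> of size \<open>2 ^ k \<approx> C n log n\<close> on which \<open>A\<close> has density at least
  \<open>1/2 + \<epsilon>\<close>; as \<open>V\<close> is closed under addition, a fraction \<open>1/2 + \<epsilon>\<close> of the pairs of \<open>V\<close> then has its sum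
  in \<open>A\<close>. Such a \<open>V\<close> is found by the second moment method among the graphs of the linear maps from
  \<open>F_2 ^ k\<close> to \<open>F_2 ^ (n - k)\<close>. For a fixed \<open>V\<close> the event has probability \<open>q \<ge> 2 ^ (- 2 \<epsilon> |V| - 2)\<close>. For two
  graphs with \<open>D\<close> common points both events hold with probability at most \<open>min (2 ^ D * q\<^sup>2) q\<close>,
  which for small \<open>\<epsilon>\<close> is at most \<open>2 * D ^ s * q\<^sup>2\<close> with \<open>s = n div 4\<close>: use the first bound for \<open>D \<le> s\<close> and
  the second one otherwise. Two random linear maps agree essentially only at \<open>0\<close>: building them
  column by column shows that the mean of \<open>D ^ s\<close> is at most \<open>3\<close>.
\<close>

section \<open>Counting subsets\<close>

text \<open>Counting form of independence: a subset of \<open>S\<close> is a free choice of its part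
  in \<open>T\<close> and of its part outside. Dividing by \<open>2 ^ card S\<close> turns such
  counts into probabilities.\<close>

lemma card_subsets_split:
  assumes "finite S" "T \<subseteq> S"
  shows "card {A. A \<subseteq> S \<and> P (A \<inter> T) \<and> Q (A - T)}
       = card {B. B \<subseteq> T \<and> P B} * card {D. D \<subseteq> S - T \<and> Q D}"
proof -
  have "bij_betw (\<lambda>A. (A \<inter> T, A - T)) {A. A \<subseteq> S \<and> P (A \<inter> T) \<and> Q (A - T)}
          ({B. B \<subseteq> T \<and> P B} \<times> {D. D \<subseteq> S - T \<and> Q D})"
  proof (rule bij_betwI[where g = "\<lambda>(B, D). B \<union> D"], goal_cases)
    case 2
    have "(B \<union> D) \<inter> T = B" "(B \<union> D) - T = D" if "B \<subseteq> T" "D \<subseteq> S - T" for B D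
      using that by auto
    then show ?case
      using assms(2) by auto
  qed auto
  then show ?thesis
    by (simp add: bij_betw_same_card card_cartesian_product)
qed

lemma card_supersets:
  assumes "finite S" "T \<subseteq> S"
  shows "card {A. A \<subseteq> S \<and> T \<subseteq> A} = 2 ^ (card S - card T)"
proof -
  have "{A. A \<subseteq> S \<and> T \<subseteq> A} = {A. A \<subseteq> S \<and> A \<inter> T = T \<and> True}"
    by auto
  also have "card \<dots> = card {B. B \<subseteq> T \<and> B = T} * card {D. D \<subseteq> S - T \<and> True}"
    using assms by (rule card_subsets_split)
  also have "{B. B \<subseteq> T \<and> B = T} = {T}"
    by auto
  also have "{D. D \<subseteq> S - T \<and> True} = Pow (S - T)"
    by auto
  finally show ?thesis
    using assms by (simp add: card_Pow card_Diff_subset finite_subset)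
qed

text \<open>Complementation in \<open>T\<close> takes small subsets to large ones, so the large ones
  and their complements cover the power set.\<close>

lemma half_subsets_large:
  assumes "finite T"
  shows "2 ^ card T \<le> 2 * card {B. B \<subseteq> T \<and> card T \<le> 2 * card B}"
proof -
  let ?L = "{B. B \<subseteq> T \<and> card T \<le> 2 * card B}"
  have fin: "finite ?L"
    using assms by auto
  have "Pow T \<subseteq> ?L \<union> (\<lambda>B. T - B) ` ?L"
  proof
    fix B assume B: "B \<in> Pow T"
    then have "card (T - B) = card T - card B"
      using assms by (auto intro: card_Diff_subset finite_subset)
    moreover have "B = T - (T - B)"
      using B by auto
    ultimately show "B \<in> ?L \<union> (\<lambda>B. T - B) ` ?L"
      using B by (cases "card T \<le> 2 * card B") auto
  qed
  then have "card (Pow T) \<le> card (?L \<union> (\<lambda>B. T - B) ` ?L)"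
    using fin by (intro card_mono) auto
  also have "\<dots> \<le> card ?L + card ((\<lambda>B. T - B) ` ?L)"
    by (rule card_Un_le)
  also have "\<dots> \<le> card ?L + card ?L"
    using fin by (intro add_left_mono card_image_le)
  finally show ?thesis
    using assms by (simp add: card_Pow)
qed

section \<open>Sets with many elements in a given subset\<close>

definition heavy :: "'a set \<Rightarrow> real \<Rightarrow> 'a set \<Rightarrow> 'a set set" where
  "heavy S t V = {A. A \<subseteq> S \<and> t \<le> real (card (A \<inter> V))}"

lemma finite_heavy [simp]: "finite S \<Longrightarrow> finite (heavy S t V)"
  by (simp add: heavy_def)

lemma card_heavy:
  assumes "finite S" "V \<subseteq> S"
  shows "card (heavy S t V)
       = card {B. B \<subseteq> V \<and> t \<le> real (card B)} * 2 ^ (card S - card V)"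
proof -
  have "heavy S t V = {A. A \<subseteq> S \<and> t \<le> real (card (A \<inter> V)) \<and> True}"
    by (simp add: heavy_def)
  also have "card \<dots> = card {B. B \<subseteq> V \<and> t \<le> real (card B)} * card {D. D \<subseteq> S - V \<and> True}"
    using assms by (rule card_subsets_split)
  also have "{D. D \<subseteq> S - V \<and> True} = Pow (S - V)"
    by auto
  finally show ?thesis
    using assms by (simp add: card_Pow card_Diff_subset finite_subset)
qed

text \<open>A bijection from \<open>V\<close> to \<open>W\<close> acts on subsets and preserves
  their size. Applied in both directions it shows that the probability of being heavy depends only
  on the size of \<open>V\<close>.\<close>

lemma card_heavy_mono:
  assumes "finite S" "V \<subseteq> S" "W \<subseteq> S" "card V = card W"
  shows "card (heavy S t V) \<le> card (heavy S t W)"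
proof -
  have fin: "finite V" "finite W"
    using assms finite_subset by auto
  then obtain g where g: "bij_betw g V W"
    using assms(4) finite_same_card_bij by blast
  have inj: "inj_on g B" if "B \<subseteq> V" for B
    using g that by (auto simp: bij_betw_def intro: inj_on_subset)
  have "card {B. B \<subseteq> V \<and> t \<le> real (card B)} \<le> card {B. B \<subseteq> W \<and> t \<le> real (card B)}"
  proof (rule card_inj_on_le)
    show "inj_on ((`) g) {B. B \<subseteq> V \<and> t \<le> real (card B)}"
      using inj[of V] by (auto intro!: inj_onI dest: inj_on_image_eq_iff)
    show "(`) g ` {B. B \<subseteq> V \<and> t \<le> real (card B)} \<subseteq> {B. B \<subseteq> W \<and> t \<le> real (card B)}"
      using g inj by (auto simp: card_image bij_betw_def)
  qed (use fin in auto)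
  then show ?thesis
    using assms by (simp add: card_heavy)
qed

lemma card_heavy_eq:
  assumes "finite S" "V \<subseteq> S" "W \<subseteq> S" "card V = card W"
  shows "card (heavy S t V) = card (heavy S t W)"
  using assms card_heavy_mono[of S V W t] card_heavy_mono[of S W V t] by simp

text \<open>Force \<open>f\<close> elements of \<open>V\<close> into the set; with probability at least one half it contains
  at least half of the others.\<close>

lemma card_heavy_ge:
  assumes "finite S" "V \<subseteq> S" "f \<le> card V" "2 * t \<le> real (card V) + real f"
  shows "2 ^ card S \<le> 2 ^ (f + 1) * card (heavy S t V)"
proof -
  have finV: "finite V"
    using assms finite_subset by auto
  obtain G where G: "G \<subseteq> V" "card G = f"
    using obtain_subset_with_card_n[OF assms(3)] by blast
  have finG: "finite G"
    using G finV finite_subset by auto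
  have cardVG: "card (V - G) = card V - f"
    using G finG by (simp add: card_Diff_subset)
  let ?L = "{B. B \<subseteq> V - G \<and> card (V - G) \<le> 2 * card B}"
  have "card ?L \<le> card {B. B \<subseteq> V \<and> t \<le> real (card B)}"
  proof (rule card_inj_on_le)
    show "inj_on ((\<union>) G) ?L"
      by (rule inj_onI) auto
    show "(\<union>) G ` ?L \<subseteq> {B. B \<subseteq> V \<and> t \<le> real (card B)}"
    proof clarsimp
      fix B assume B: "B \<subseteq> V - G" "card (V - G) \<le> 2 * card B"
      \<comment> \<open>As \<open>2 * card B\<close> is at least \<open>card V - f\<close>, twice
        the size of the union is at least \<open>card V + f\<close>, which bounds
        \<open>2 * t\<close>.\<close>
      have "card (G \<union> B) = f + card B"
        using B finG finV G by (subst card_Un_disjoint) (auto intro: finite_subset)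
      then show "G \<subseteq> V \<and> B \<subseteq> V \<and> t \<le> real (card (G \<union> B))"
        using B G assms(3,4) cardVG by auto
    qed
  qed (use finV in auto)
  moreover have "2 ^ (card V - f) \<le> 2 * card ?L"
    using half_subsets_large[of "V - G"] finV cardVG by simp
  ultimately have "2 ^ (card V - f) \<le> 2 * card {B. B \<subseteq> V \<and> t \<le> real (card B)}"
    by linarith
  then have "2 ^ (card V - f) * 2 ^ (f + (card S - card V))
      \<le> 2 * card {B. B \<subseteq> V \<and> t \<le> real (card B)} * 2 ^ (f + (card S - card V))"
    by (rule mult_right_mono) simp
  also have "\<dots> = 2 ^ (f + 1) * card (heavy S t V)"
    using assms by (simp add: card_heavy power_add mult_ac)
  also have "2 ^ (card V - f) * 2 ^ (f + (card S - card V)) = (2::nat) ^ card S"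
    using assms card_mono[of S V] by (simp flip: power_add)
  finally show ?thesis .
qed

text \<open>If \<open>A\<close> is heavy on \<open>W\<close>, then so is \<open>A \<union> (V \<inter> W)\<close>, which is a condition on \<open>A - V\<close> only
  and hence independent of \<open>A\<close> being heavy on \<open>V\<close>.\<close>

lemma card_heavy_Int_le:
  assumes "finite S" "V \<subseteq> S" "W \<subseteq> S"
  shows "card (heavy S t V \<inter> heavy S t W) * 2 ^ card S
       \<le> 2 ^ card (V \<inter> W) * (card (heavy S t V) * card (heavy S t W))"
proof -
  have fin: "finite V" "finite W"
    using assms finite_subset by auto
  let ?U = "V \<inter> W"
  let ?Q = "\<lambda>D. t \<le> real (card (D \<inter> W)) + real (card ?U)"
  define a where "a = card {B. B \<subseteq> V \<and> t \<le> real (card B)}"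
  define b where "b = card {D. D \<subseteq> S - V \<and> ?Q D}"
  have "heavy S t V \<inter> heavy S t W
      \<subseteq> {A. A \<subseteq> S \<and> t \<le> real (card (A \<inter> V)) \<and> ?Q (A - V)}"
  proof (clarsimp simp: heavy_def)
    fix A assume "t \<le> real (card (A \<inter> W))"
    moreover have "A \<inter> W \<subseteq> (A - V) \<inter> W \<union> ?U"
      by auto
    then have "card (A \<inter> W) \<le> card ((A - V) \<inter> W \<union> ?U)"
      using fin by (intro card_mono) auto
    then have "card (A \<inter> W) \<le> card ((A - V) \<inter> W) + card ?U"
      using card_Un_le le_trans by blast
    ultimately show "?Q (A - V)"
      by linarith
  qed
  then have "card (heavy S t V \<inter> heavy S t W)
      \<le> card {A. A \<subseteq> S \<and> t \<le> real (card (A \<inter> V)) \<and> ?Q (A - V)}"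
    using assms(1) by (intro card_mono) auto
  also have "\<dots> = a * b"
    unfolding a_def b_def using assms(1,2) by (rule card_subsets_split)
  finally have upper: "card (heavy S t V \<inter> heavy S t W) \<le> a * b" .
  \<comment> \<open>Conversely, \<open>?Q (A - V)\<close> gives heaviness on \<open>W\<close> once
    \<open>A\<close> contains the overlap. Demanding this containment costs the factor
    \<open>2 ^ card ?U\<close> of the statement.\<close>
  have "{A. A \<subseteq> S \<and> ?U \<subseteq> A \<inter> V \<and> ?Q (A - V)} \<subseteq> heavy S t W"
  proof (clarsimp simp: heavy_def)
    fix A assume A: "A \<subseteq> S" "?U \<subseteq> A" "?Q (A - V)"
    then have "card (A \<inter> W) = card (((A - V) \<inter> W) \<union> ?U)"
      by (intro arg_cong[where f = card]) auto
    also have "\<dots> = card ((A - V) \<inter> W) + card ?U"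
      using fin by (intro card_Un_disjoint) auto
    finally show "t \<le> real (card (A \<inter> W))"
      using A by simp
  qed
  then have "card {A. A \<subseteq> S \<and> ?U \<subseteq> A \<inter> V \<and> ?Q (A - V)} \<le> card (heavy S t W)"
    using assms(1) by (intro card_mono) auto
  moreover have "card {A. A \<subseteq> S \<and> ?U \<subseteq> A \<inter> V \<and> ?Q (A - V)} = card {B. B \<subseteq> V \<and> ?U \<subseteq> B} * b"
    unfolding b_def using assms(1,2) by (rule card_subsets_split)
  ultimately have lower: "2 ^ (card V - card ?U) * b \<le> card (heavy S t W)"
    using fin by (simp add: card_supersets)
  have "card V \<le> card S" "card ?U \<le> card V"
    using assms fin by (auto intro: card_mono)
  then have "(2::nat) ^ card S
      = 2 ^ card ?U * 2 ^ (card V - card ?U) * 2 ^ (card S - card V)"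
    by (simp flip: power_add)
  then have "a * b * 2 ^ card S
      = 2 ^ card ?U * (a * 2 ^ (card S - card V) * (2 ^ (card V - card ?U) * b))"
    by (simp add: mult_ac)
  also have "\<dots> \<le> 2 ^ card ?U * (card (heavy S t V) * card (heavy S t W))"
    using lower assms by (intro mult_left_mono mult_mono) (auto simp: card_heavy a_def)
  finally show ?thesis
    using upper by (meson le_trans mult_le_mono1)
qed

text \<open>Cauchy-Schwarz on the union, for the constant 1 and the number \<open>z A\<close> of
  indices \<open>i\<close> with \<open>A\<close> in \<open>E i\<close>.\<close>

lemma card_UN_second_moment:
  fixes E :: "'i \<Rightarrow> 'a set"
  assumes "finite I" "\<And>i. i \<in> I \<Longrightarrow> finite (E i)"
  shows "(\<Sum>i\<in>I. real (card (E i)))\<^sup>2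
       \<le> real (card (\<Union>i\<in>I. E i)) * (\<Sum>i\<in>I. \<Sum>j\<in>I. real (card (E i \<inter> E j)))"
proof -
  define U where "U = (\<Union>i\<in>I. E i)"
  have finU: "finite U"
    using assms by (simp add: U_def)
  define z where "z A = (\<Sum>i\<in>I. indicator (E i) A :: real)" for A
  have card_eq: "real (card B) = (\<Sum>A\<in>U. indicator B A)" if "B \<subseteq> U" for B
    using that finU by (simp add: indicator_def sum.If_cases Int_absorb1 flip: sum.inter_restrict)
  have sub: "E i \<subseteq> U" if "i \<in> I" for i
    using that by (auto simp: U_def)
  have "(\<Sum>i\<in>I. real (card (E i))) = (\<Sum>i\<in>I. \<Sum>A\<in>U. indicator (E i) A)"
    using sub by (intro sum.cong refl card_eq)
  also have "\<dots> = (\<Sum>A\<in>U. 1 * z A)"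
    unfolding z_def by (subst sum.swap) simp
  finally have first: "(\<Sum>i\<in>I. real (card (E i))) = (\<Sum>A\<in>U. 1 * z A)" .
  have "(\<Sum>i\<in>I. \<Sum>j\<in>I. real (card (E i \<inter> E j)))
      = (\<Sum>i\<in>I. \<Sum>j\<in>I. \<Sum>A\<in>U. indicator (E i \<inter> E j) A)"
    using sub by (intro sum.cong refl card_eq) auto
  also have "\<dots> = (\<Sum>i\<in>I. \<Sum>A\<in>U. \<Sum>j\<in>I. indicator (E i \<inter> E j) A)"
    by (intro sum.cong refl sum.swap)
  also have "\<dots> = (\<Sum>A\<in>U. \<Sum>i\<in>I. \<Sum>j\<in>I. indicator (E i \<inter> E j) A)"
    by (rule sum.swap)
  also have "\<dots> = (\<Sum>A\<in>U. (z A)\<^sup>2)"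
    by (simp add: z_def power2_eq_square sum_product indicator_inter_arith)
  finally have second: "(\<Sum>i\<in>I. \<Sum>j\<in>I. real (card (E i \<inter> E j))) = (\<Sum>A\<in>U. (z A)\<^sup>2)" .
  show ?thesis
    using Cauchy_Schwarz_ineq_sum[of "\<lambda>_. 1" z U]
    unfolding first second by (simp add: U_def)
qed

section \<open>Graphs of linear maps over the two-element field\<close>

lemma carrier_vec_bit_Suc:
  "F2_space (Suc n) = vCons 0 ` F2_space n \<union> vCons 1 ` F2_space n"
proof
  show "F2_space (Suc n) \<subseteq> vCons 0 ` F2_space n \<union> vCons 1 ` F2_space n"
  proof
    fix v :: "bit Matrix.vec" assume "v \<in> F2_space (Suc n)"
    then show "v \<in> vCons 0 ` F2_space n \<union> vCons 1 ` F2_space n"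
    proof (cases v)
      case (vCons a w)
      then show ?thesis
        using \<open>v \<in> F2_space (Suc n)\<close> by (cases a) auto
    qed auto
  qed
qed auto

lemma finite_card_F2_space: "finite (F2_space n) \<and> card (F2_space n) = 2 ^ n"
proof (induction n)
  case 0
  have "F2_space 0 = {0\<^sub>v 0}"
    by auto
  then show ?case
    by simp
next
  case (Suc n)
  have "inj_on (vCons a) (F2_space n)" for a :: bit
    by (auto intro: inj_onI)
  moreover have "vCons 0 ` F2_space n \<inter> vCons 1 ` F2_space n = {}"
    by auto
  ultimately show ?case
    using Suc by (simp add: carrier_vec_bit_Suc card_Un_disjoint card_image)
qed

lemma finite_F2_space [simp]: "finite (F2_space n)"
  and card_F2_space [simp]: "card (F2_space n) = 2 ^ n"
  using finite_card_F2_space by auto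

text \<open>Characteristic two makes every translation its own inverse; this supplies the inverse
  maps in the later counting arguments.\<close>

lemma F2_add_add_cancel:
  assumes "x \<in> F2_space n" "y \<in> F2_space n"
  shows "x + (x + y) = y"
proof (rule eq_vecI)
  fix i assume "i < dim_vec y"
  then show "(x + (x + y)) $ i = y $ i"
    using assms by (cases "x $ i"; cases "y $ i") auto
qed (use assms in auto)

section \<open>Linear maps given by their columns, and where two of them agree\<close>

lemma mat_of_cols_Cons_mult_vCons:
  fixes c :: "'a::comm_semiring_0 Matrix.vec"
  assumes "c \<in> carrier_vec m" "x \<in> carrier_vec (length cs)"
  shows "mat_of_cols m (c # cs) *\<^sub>v vCons a x = a \<cdot>\<^sub>v c + mat_of_cols m cs *\<^sub>v x"
proof (rule eq_vecI)
  fix i assume "i < dim_vec (a \<cdot>\<^sub>v c + mat_of_cols m cs *\<^sub>v x)"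
  then have i: "i < m"
    by simp
  have "row (mat_of_cols m (c # cs)) i = vCons (c $ i) (row (mat_of_cols m cs) i)"
  proof (rule eq_vecI)
    fix j assume "j < dim_vec (vCons (c $ i) (row (mat_of_cols m cs) i))"
    then show "row (mat_of_cols m (c # cs)) i $ j = vCons (c $ i) (row (mat_of_cols m cs) i) $ j"
      using i by (cases j) (auto simp: mat_of_cols_index)
  qed simp
  then show "(mat_of_cols m (c # cs) *\<^sub>v vCons a x) $ i
      = (a \<cdot>\<^sub>v c + mat_of_cols m cs *\<^sub>v x) $ i"
    using i assms by (simp add: mult.commute)
qed simp

text \<open>Encodes the linear maps from \<open>F_2 ^ k\<close> to \<open>F_2 ^ m\<close>; as lists
  of columns they can be built by prepending independent columns.\<close>

definition column_lists :: "nat \<Rightarrow> nat \<Rightarrow> bit Matrix.vec list set" where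
  "column_lists m k = {cs. set cs \<subseteq> F2_space m \<and> length cs = k}"

lemma finite_column_lists [simp]: "finite (column_lists m k)"
  by (simp add: column_lists_def finite_lists_length_eq)

lemma card_column_lists: "card (column_lists m k) = 2 ^ (m * k)"
  by (simp add: column_lists_def card_lists_length_eq power_mult)

lemma sum_column_lists_Suc:
  "(\<Sum>cs\<in>column_lists m (Suc k). g cs) = (\<Sum>cs\<in>column_lists m k. \<Sum>c\<in>F2_space m. g (c # cs))"
proof -
  have "column_lists m (Suc k) = (\<lambda>(cs, c). c # cs) ` (column_lists m k \<times> F2_space m)"
    by (fastforce simp: column_lists_def length_Suc_conv image_iff)
  then have "(\<Sum>cs\<in>column_lists m (Suc k). g cs)
      = (\<Sum>(cs, c)\<in>column_lists m k \<times> F2_space m. g (c # cs))"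
    by (simp add: sum.reindex inj_on_def case_prod_beta)
  then show ?thesis
    by (simp add: sum.cartesian_product)
qed

text \<open>For lists of equal length this is the kernel of the difference of the two maps.\<close>

definition agree :: "nat \<Rightarrow> bit Matrix.vec list \<Rightarrow> bit Matrix.vec list \<Rightarrow> bit Matrix.vec set" where
  "agree m cs ds =
    {x \<in> F2_space (length cs). mat_of_cols m cs *\<^sub>v x = mat_of_cols m ds *\<^sub>v x}"

lemma finite_agree [simp]: "finite (agree m cs ds)"
  by (simp add: agree_def)

text \<open>Split by the first coordinate: a vector starting with 0 extends an old agreement, and
  one starting with 1 has its tail in \<open>R\<close>, the solution set of an affine system over
  the old kernel. \<open>R\<close> is empty or no larger than that kernel, and any solution forces
  \<open>c\<close> into the displayed image.\<close>

lemma card_agree_Cons_le: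
  assumes cs: "cs \<in> column_lists m k" and ds: "ds \<in> column_lists m k"
    and c: "c \<in> F2_space m" and d: "d \<in> F2_space m"
  defines "C \<equiv> mat_of_cols m cs" and "D \<equiv> mat_of_cols m ds"
  shows "card (agree m (c # cs) (d # ds))
       \<le> (if c \<in> (\<lambda>x. d + (D *\<^sub>v x + C *\<^sub>v x)) ` F2_space k then 2 else 1) * card (agree m cs ds)"
proof -
  have len: "length cs = k" "length ds = k"
    using cs ds by (auto simp: column_lists_def)
  have C: "C \<in> carrier_mat m k" and D: "D \<in> carrier_mat m k"
    using len by (auto simp: C_def D_def)
  define R where "R = {x \<in> F2_space k. c + C *\<^sub>v x = d + D *\<^sub>v x}"
  have "agree m (c # cs) (d # ds) \<subseteq> vCons 0 ` agree m cs ds \<union> vCons 1 ` R"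
  proof
    fix v assume v: "v \<in> agree m (c # cs) (d # ds)"
    then have "v \<in> F2_space (Suc k)"
      by (simp add: agree_def len)
    then obtain a x where x: "v = vCons a x" "x \<in> F2_space k"
      unfolding carrier_vec_bit_Suc by auto
    have "a \<cdot>\<^sub>v c + C *\<^sub>v x = a \<cdot>\<^sub>v d + D *\<^sub>v x"
      using v x len c d by (simp add: agree_def mat_of_cols_Cons_mult_vCons C_def D_def)
    moreover have "0 \<cdot>\<^sub>v u + w = w" "1 \<cdot>\<^sub>v u = u" if "u \<in> F2_space m" "w \<in> F2_space m" for u w
      using that by auto
    ultimately show "v \<in> vCons 0 ` agree m cs ds \<union> vCons 1 ` R"
      using x c d C D len by (cases a) (auto simp: agree_def R_def C_def D_def)
  qed
  then have "card (agree m (c # cs) (d # ds)) \<le> card (vCons 0 ` agree m cs ds \<union> vCons 1 ` R)"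
    by (intro card_mono) (auto simp: R_def)
  also have "\<dots> \<le> card (vCons 0 ` agree m cs ds) + card (vCons 1 ` R)"
    by (rule card_Un_le)
  also have "\<dots> \<le> card (agree m cs ds) + card R"
    by (intro add_mono card_image_le) (auto simp: R_def)
  finally have le: "card (agree m (c # cs) (d # ds)) \<le> card (agree m cs ds) + card R" .
  show ?thesis
  proof (cases "R = {}")
    case True
    then show ?thesis
      using le by auto
  next
    case False
    then obtain y where y: "y \<in> F2_space k" "c + C *\<^sub>v y = d + D *\<^sub>v y"
      by (auto simp: R_def)
    have "c = d + (D *\<^sub>v y + C *\<^sub>v y)"
    proof (rule eq_vecI)
      fix i assume "i < dim_vec (d + (D *\<^sub>v y + C *\<^sub>v y))"
      then have i: "i < m"
        using C by auto
      have "(c + C *\<^sub>v y) $ i = (d + D *\<^sub>v y) $ i"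
        using y by simp
      then show "c $ i = (d + (D *\<^sub>v y + C *\<^sub>v y)) $ i"
        using i C D c d
        by (cases "c $ i"; cases "d $ i"; cases "(C *\<^sub>v y) $ i"; cases "(D *\<^sub>v y) $ i")
           (auto simp del: index_mult_mat_vec)
    qed (use C c in auto)
    \<comment> \<open>Translation by the solution \<open>y\<close> moves \<open>R\<close> into the
      kernel.\<close>
    moreover have "card R \<le> card (agree m cs ds)"
    proof (rule card_inj_on_le)
      show "inj_on ((+) y) R"
        using y F2_add_add_cancel[of y k] by (intro inj_on_inverseI[where g = "(+) y"]) (auto simp: R_def)
      show "(+) y ` R \<subseteq> agree m cs ds"
      proof clarify
        fix x assume "x \<in> R"
        then have x: "x \<in> F2_space k" "c + C *\<^sub>v x = d + D *\<^sub>v x"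
          by (auto simp: R_def)
        have "C *\<^sub>v y + C *\<^sub>v x = D *\<^sub>v y + D *\<^sub>v x"
        proof (rule eq_vecI)
          fix i assume "i < dim_vec (D *\<^sub>v y + D *\<^sub>v x)"
          then have i: "i < m"
            using D by auto
          have "(c + C *\<^sub>v y) $ i = (d + D *\<^sub>v y) $ i" "(c + C *\<^sub>v x) $ i = (d + D *\<^sub>v x) $ i"
            using x y by simp_all
          then show "(C *\<^sub>v y + C *\<^sub>v x) $ i = (D *\<^sub>v y + D *\<^sub>v x) $ i"
            using i C D c d
            by (cases "c $ i"; cases "d $ i"; cases "(C *\<^sub>v y) $ i"; cases "(D *\<^sub>v y) $ i";
                cases "(C *\<^sub>v x) $ i"; cases "(D *\<^sub>v x) $ i")
               (auto simp del: index_mult_mat_vec)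
        qed (use C D in auto)
        then show "y + x \<in> agree m cs ds"
          using x y C D len
          by (auto simp: agree_def C_def D_def mult_add_distrib_mat_vec[where nc = k and nr = m])
      qed
    qed simp
    ultimately show ?thesis
      using le y(1) by auto
  qed
qed

text \<open>Appending a column doubles the agreement set only if the difference of the new columns lies
  in the image of the difference of the old maps, which has at most \<open>2 ^ k\<close> elements.\<close>

lemma sum_card_agree_Cons_le:
  assumes "cs \<in> column_lists m k" "ds \<in> column_lists m k"
  shows "(\<Sum>d\<in>F2_space m. \<Sum>c\<in>F2_space m. card (agree m (c # cs) (d # ds)) ^ s)
       \<le> (2 ^ (2 * m) + 2 ^ (m + k + s)) * card (agree m cs ds) ^ s"
proof -
  let ?K = "card (agree m cs ds) ^ s"
  define B where
    "B d = (\<lambda>x. d + (mat_of_cols m ds *\<^sub>v x + mat_of_cols m cs *\<^sub>v x)) ` F2_space k" for d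
  have finB: "finite (B d)" and cardB: "card (B d) \<le> 2 ^ k" for d
    unfolding B_def by (auto intro: order_trans[OF card_image_le])
  \<comment> \<open>With \<open>d\<close> fixed, at most \<open>2 ^ k\<close> choices of
    \<open>c\<close> can enlarge the agreement set, each raising the \<open>s\<close>-th power by a
    factor of at most \<open>2 ^ s\<close>.\<close>
  have "(\<Sum>c\<in>F2_space m. card (agree m (c # cs) (d # ds)) ^ s) \<le> (2 ^ m + 2 ^ (k + s)) * ?K"
    if d: "d \<in> F2_space m" for d
  proof -
    have "(\<Sum>c\<in>F2_space m. card (agree m (c # cs) (d # ds)) ^ s)
        \<le> (\<Sum>c\<in>F2_space m. ?K + (if c \<in> B d then 2 ^ s * ?K else 0))"
    proof (rule sum_mono)
      fix c :: "bit Matrix.vec" assume "c \<in> F2_space m"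
      from power_mono[OF card_agree_Cons_le[OF assms this d], of s]
      show "card (agree m (c # cs) (d # ds)) ^ s \<le> ?K + (if c \<in> B d then 2 ^ s * ?K else 0)"
        by (auto simp: B_def power_mult_distrib split: if_splits)
    qed
    also have "\<dots> = 2 ^ m * ?K + card (F2_space m \<inter> B d) * (2 ^ s * ?K)"
      by (simp add: sum.distrib flip: sum.inter_restrict)
    also have "\<dots> \<le> 2 ^ m * ?K + 2 ^ k * (2 ^ s * ?K)"
      using card_mono[OF finB[of d], of "F2_space m \<inter> B d"] cardB[of d]
      by (intro add_left_mono mult_right_mono) auto
    finally show ?thesis
      by (simp add: power_add algebra_simps)
  qed
  then have "(\<Sum>d\<in>F2_space m. \<Sum>c\<in>F2_space m. card (agree m (c # cs) (d # ds)) ^ s)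
      \<le> (\<Sum>d\<in>F2_space m. (2 ^ m + 2 ^ (k + s)) * ?K)"
    by (rule sum_mono)
  also have "\<dots> = (2 ^ (2 * m) + 2 ^ (m + k + s)) * ?K"
    by (simp add: power_add mult_2 distrib_right distrib_left mult.assoc)
  finally show ?thesis .
qed

text \<open>Iterates the one-column estimate. The fixed bound \<open>K\<close> on the number of
  columns keeps the factor the same throughout the induction.\<close>

lemma sum_card_agree_le:
  assumes "k \<le> K"
  shows "(\<Sum>cs\<in>column_lists m k. \<Sum>ds\<in>column_lists m k. card (agree m cs ds) ^ s)
       \<le> (2 ^ (2 * m) + 2 ^ (m + K + s)) ^ k"
  using assms
proof (induction k)
  case 0
  have "column_lists m 0 = {[]}" "agree m [] [] = F2_space 0"
    by (auto simp: column_lists_def agree_def)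
  then show ?case
    by simp
next
  case (Suc k)
  let ?b = "(2::nat) ^ (2 * m) + 2 ^ (m + K + s)"
  have "(\<Sum>cs\<in>column_lists m (Suc k). \<Sum>ds\<in>column_lists m (Suc k). card (agree m cs ds) ^ s)
      = (\<Sum>cs\<in>column_lists m k. \<Sum>c\<in>F2_space m. \<Sum>ds\<in>column_lists m k. \<Sum>d\<in>F2_space m.
          card (agree m (c # cs) (d # ds)) ^ s)"
    by (simp add: sum_column_lists_Suc)
  also have "\<dots> = (\<Sum>cs\<in>column_lists m k. \<Sum>ds\<in>column_lists m k. \<Sum>d\<in>F2_space m. \<Sum>c\<in>F2_space m.
          card (agree m (c # cs) (d # ds)) ^ s)"
  proof (rule sum.cong[OF refl])
    fix cs
    have "(\<Sum>c\<in>F2_space m. \<Sum>ds\<in>column_lists m k. \<Sum>d\<in>F2_space m. card (agree m (c # cs) (d # ds)) ^ s)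
        = (\<Sum>ds\<in>column_lists m k. \<Sum>c\<in>F2_space m. \<Sum>d\<in>F2_space m. card (agree m (c # cs) (d # ds)) ^ s)"
      by (rule sum.swap)
    also have "\<dots> = (\<Sum>ds\<in>column_lists m k. \<Sum>d\<in>F2_space m. \<Sum>c\<in>F2_space m. card (agree m (c # cs) (d # ds)) ^ s)"
      by (intro sum.cong refl sum.swap)
    finally show "(\<Sum>c\<in>F2_space m. \<Sum>ds\<in>column_lists m k. \<Sum>d\<in>F2_space m. card (agree m (c # cs) (d # ds)) ^ s)
        = (\<Sum>ds\<in>column_lists m k. \<Sum>d\<in>F2_space m. \<Sum>c\<in>F2_space m. card (agree m (c # cs) (d # ds)) ^ s)" .
  qed
  also have "\<dots> \<le> (\<Sum>cs\<in>column_lists m k. \<Sum>ds\<in>column_lists m k.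
      (2 ^ (2 * m) + 2 ^ (m + k + s)) * card (agree m cs ds) ^ s)"
    by (intro sum_mono sum_card_agree_Cons_le)
  also have "\<dots> \<le> (\<Sum>cs\<in>column_lists m k. \<Sum>ds\<in>column_lists m k. ?b * card (agree m cs ds) ^ s)"
    using Suc.prems by (intro sum_mono mult_right_mono add_left_mono power_increasing) auto
  also have "\<dots> = ?b * (\<Sum>cs\<in>column_lists m k. \<Sum>ds\<in>column_lists m k. card (agree m cs ds) ^ s)"
    by (simp add: sum_distrib_left)
  also have "\<dots> \<le> ?b * ?b ^ k"
    using Suc by (intro mult_left_mono) auto
  finally show ?case
    by simp
qed

section \<open>Graphs of linear maps as subspaces\<close>

definition graph :: "nat \<Rightarrow> bit Matrix.vec list \<Rightarrow> bit Matrix.vec set" where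
  "graph m cs = (\<lambda>x. x @\<^sub>v (mat_of_cols m cs *\<^sub>v x)) ` F2_space (length cs)"

lemma graph_subset: "cs \<in> column_lists m k \<Longrightarrow> graph m cs \<subseteq> F2_space (k + m)"
  by (auto simp: graph_def column_lists_def intro!: mult_mat_vec_carrier append_carrier_vec)

lemma card_graph:
  assumes "cs \<in> column_lists m k"
  shows "card (graph m cs) = 2 ^ k"
proof -
  have "inj_on (\<lambda>x. x @\<^sub>v (mat_of_cols m cs *\<^sub>v x)) (F2_space k)"
    by (rule inj_onI) (simp add: append_vec_eq)
  then show ?thesis
    using assms by (simp add: graph_def column_lists_def card_image)
qed

text \<open>The first \<open>k\<close> coordinates of a point of a graph determine it, so two graphs
  meet exactly above the agreement set.\<close>

lemma card_graph_Int:
  assumes "cs \<in> column_lists m k" "ds \<in> column_lists m k"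
  shows "card (graph m cs \<inter> graph m ds) = card (agree m cs ds)"
proof -
  have len: "length cs = k" "length ds = k"
    using assms by (auto simp: column_lists_def)
  have "graph m cs \<inter> graph m ds = (\<lambda>x. x @\<^sub>v (mat_of_cols m cs *\<^sub>v x)) ` agree m cs ds"
    by (auto simp: graph_def agree_def len append_vec_eq image_iff)
  moreover have "inj_on (\<lambda>x. x @\<^sub>v (mat_of_cols m cs *\<^sub>v x)) (agree m cs ds)"
    by (rule inj_onI) (auto simp: agree_def append_vec_eq)
  ultimately show ?thesis
    by (simp add: card_image)
qed

lemma graph_add_closed:
  assumes "cs \<in> column_lists m k" "u \<in> graph m cs" "v \<in> graph m cs"
  shows "u + v \<in> graph m cs"
proof -
  have len: "length cs = k"
    using assms by (simp add: column_lists_def)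
  let ?C = "mat_of_cols m cs"
  have C: "?C \<in> carrier_mat m k"
    using len by auto
  obtain x y where xy: "x \<in> F2_space k" "y \<in> F2_space k" "u = x @\<^sub>v (?C *\<^sub>v x)" "v = y @\<^sub>v (?C *\<^sub>v y)"
    using assms len by (auto simp: graph_def)
  then have "u + v = (x + y) @\<^sub>v (?C *\<^sub>v (x + y))"
    using C by (simp add: append_vec_add[where n = k and m = m]
        mult_add_distrib_mat_vec[where nr = m and nc = k])
  then show ?thesis
    using xy len by (auto simp: graph_def)
qed

text \<open>The map \<open>(x, y) \<mapsto> (x, x + y)\<close> is an involution of
  \<open>V \<times> V\<close>, so each element of \<open>V\<close> is the sum of equally many
  pairs.\<close>

lemma card_sum_pairs_closed:
  assumes "V \<subseteq> F2_space n" "\<And>u v. u \<in> V \<Longrightarrow> v \<in> V \<Longrightarrow> u + v \<in> V"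
  shows "card {(x1, x2) \<in> V \<times> V. x1 + x2 \<in> A} = card V * card (A \<inter> V)"
proof -
  have cancel: "x + (x + y) = y" if "x \<in> V" "y \<in> V" for x y
    using that assms(1) F2_add_add_cancel by blast
  have "bij_betw (\<lambda>(x, y). (x, x + y)) {(x1, x2) \<in> V \<times> V. x1 + x2 \<in> A} (V \<times> (A \<inter> V))"
    by (rule bij_betwI[where g = "\<lambda>(x, y). (x, x + y)"]) (auto simp: assms(2) cancel)
  then show ?thesis
    by (simp add: bij_betw_same_card card_cartesian_product)
qed

section \<open>The second moment bound\<close>

text \<open>\<open>size\<close> keeps the mean of \<open>D ^ s\<close> below 3, and
  \<open>overlap\<close> merges the two bounds for a pair of graphs into \<open>2 * D ^ s\<close>.
  The constant 6 is the product of 2 and 3.\<close>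

lemma card_heavy_graphs_ge:
  assumes size: "3 * k + s \<le> k + m"
    and f: "f \<le> 2 ^ k" "2 * t \<le> 2 ^ k + real f"
    and overlap: "\<And>D::nat. 1 \<le> D \<Longrightarrow> D \<le> 2 ^ k \<Longrightarrow> min (2 ^ D) (2 ^ (f + 1)) \<le> 2 * real D ^ s"
  shows "2 ^ 2 ^ (k + m) \<le> 6 * real (card (\<Union>cs\<in>column_lists m k. heavy (F2_space (k + m)) t (graph m cs)))"
proof -
  define S where "S = F2_space (k + m)"
  define I where "I = column_lists m k"
  define E where "E cs = heavy S t (graph m cs)" for cs
  define N :: real where "N = 2 ^ 2 ^ (k + m)"
  \<comment> \<open>The zero map serves as representative: all graphs give the same count.\<close>
  define h where "h = real (card (E (replicate k (0\<^sub>v m))))"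
  define J where "J = real (card I)"
  have finS: "finite S" and cardS: "2 ^ card S = N"
    by (simp_all add: S_def N_def)
  have sub: "graph m cs \<subseteq> S" and cardV: "card (graph m cs) = 2 ^ k" if "cs \<in> I" for cs
    using that by (auto simp: S_def I_def card_graph dest: graph_subset)
  have zero: "replicate k (0\<^sub>v m) \<in> I"
    by (auto simp: I_def column_lists_def)
  have h: "real (card (E cs)) = h" if "cs \<in> I" for cs
    using card_heavy_eq[OF finS sub[OF that] sub[OF zero]] cardV that zero
    by (simp add: h_def E_def)
  have finI: "finite I"
    by (simp add: I_def)
  have finE: "finite (E cs)" for cs
    using finS by (simp add: E_def)
  have "N \<le> real (2 ^ (f + 1) * card (E (replicate k (0\<^sub>v m))))"
    using card_heavy_ge[OF finS sub[OF zero], of f t] f cardV[OF zero] cardS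
    unfolding E_def by (metis (mono_tags) of_nat_le_iff of_nat_numeral of_nat_power)
  then have Nh: "N \<le> 2 ^ (f + 1) * h"
    by (simp add: h_def)
  have Npos: "N > 0"
    by (simp add: N_def)
  have hpos: "h > 0"
    using Nh Npos by (smt (verit) mult_nonneg_nonpos zero_le_power)
  have pair: "N * real (card (E cs \<inter> E ds)) \<le> 2 * real (card (agree m cs ds)) ^ s * h\<^sup>2"
    if cs: "cs \<in> I" and ds: "ds \<in> I" for cs ds
  proof -
    define D where "D = card (agree m cs ds)"
    \<comment> \<open>Linear maps agree at 0, so only \<open>D \<ge> 1\<close> has to be covered by
      \<open>overlap\<close>.\<close>
    have "mat_of_cols m es *\<^sub>v 0\<^sub>v k = 0\<^sub>v m" if "length es = k" for es :: "bit Matrix.vec list"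
      using that by (intro eq_vecI) auto
    then have "0\<^sub>v k \<in> agree m cs ds"
      using cs ds by (auto simp: agree_def I_def column_lists_def)
    then have D1: "1 \<le> D"
      by (auto simp: D_def Suc_le_eq card_gt_0_iff)
    have "D \<le> card (F2_space k)"
      unfolding D_def using cs by (intro card_mono) (auto simp: agree_def I_def column_lists_def)
    then have D2: "D \<le> 2 ^ k"
      by simp
    have "real (card (E cs \<inter> E ds) * 2 ^ card S)
        \<le> real (2 ^ card (graph m cs \<inter> graph m ds) * (card (E cs) * card (E ds)))"
      unfolding E_def by (intro of_nat_mono card_heavy_Int_le finS sub cs ds)
    then have "N * real (card (E cs \<inter> E ds)) \<le> 2 ^ D * h\<^sup>2"
      using cs ds cardS h by (simp add: D_def I_def card_graph_Int power2_eq_square mult.commute)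
    \<comment> \<open>For large overlaps: one of the two events is dropped, and the lower bound on
      its probability restores the second factor \<open>h\<close>.\<close>
    moreover have "N * real (card (E cs \<inter> E ds)) \<le> (2 ^ (f + 1) * h) * h"
    proof (rule mult_mono)
      have "card (E cs \<inter> E ds) \<le> card (E cs)"
        using finE by (intro card_mono) auto
      then show "real (card (E cs \<inter> E ds)) \<le> h"
        using h[OF cs] by simp
    qed (use Nh Npos hpos in auto)
    ultimately have "N * real (card (E cs \<inter> E ds)) \<le> min (2 ^ D) (2 ^ (f + 1)) * h\<^sup>2"
      by (simp add: min_def power2_eq_square mult.assoc)
    also have "\<dots> \<le> 2 * real D ^ s * h\<^sup>2"
      using overlap[OF D1 D2] by (intro mult_right_mono) auto
    finally show ?thesis
      by (simp add: D_def)
  qed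
  have "(\<Sum>cs\<in>I. \<Sum>ds\<in>I. real (card (agree m cs ds)) ^ s)
      = real (\<Sum>cs\<in>I. \<Sum>ds\<in>I. card (agree m cs ds) ^ s)"
    by simp
  also have "\<dots> \<le> real ((2 ^ (2 * m) + 2 ^ (m + k + s)) ^ k)"
    unfolding I_def by (intro of_nat_mono sum_card_agree_le) simp
  also have "\<dots> = (2 ^ (2 * m) + 2 ^ (m + k + s)) ^ k"
    by simp
  \<comment> \<open>\<open>size\<close> amounts to \<open>2 * k + s \<le> m\<close>, so the second
    summand is at most \<open>2 ^ (2 * m) / 2 ^ k\<close>; the relative error stays below
    \<open>exp 1\<close> over all \<open>k\<close> columns.\<close>
  also have "\<dots> \<le> (2 ^ (2 * m) * (1 + 1 / 2 ^ k)) ^ k"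
  proof (rule power_mono)
    have "(2::real) ^ (m + k + s) * 2 ^ k \<le> 2 ^ (2 * m)"
      unfolding power_add[symmetric] using size by (intro power_increasing) auto
    then show "(2::real) ^ (2 * m) + 2 ^ (m + k + s) \<le> 2 ^ (2 * m) * (1 + 1 / 2 ^ k)"
      by (simp add: field_simps)
  qed simp
  also have "\<dots> = J\<^sup>2 * (1 + 1 / 2 ^ k) ^ k"
    by (simp add: power_mult_distrib J_def I_def card_column_lists mult_ac flip: power_mult)
  also have "\<dots> \<le> J\<^sup>2 * 3"
  proof (rule mult_left_mono)
    have "(1 + 1 / 2 ^ k) ^ k \<le> exp (1 / 2 ^ k :: real) ^ k"
      by (intro power_mono exp_ge_add_one_self) auto
    also have "\<dots> = exp (real k / 2 ^ k)"
      by (simp flip: exp_of_nat_mult)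
    also have "\<dots> \<le> exp 1"
      using of_nat_less_two_power[of k, where ?'a = real] by (simp add: field_simps)
    also have "\<dots> \<le> 3"
      by (rule exp_le)
    finally show "(1 + 1 / 2 ^ k) ^ k \<le> (3 :: real)" .
  qed simp
  finally have agree_sum: "(\<Sum>cs\<in>I. \<Sum>ds\<in>I. real (card (agree m cs ds)) ^ s) \<le> J\<^sup>2 * 3" .
  define X where "X = real (card (\<Union>cs\<in>I. E cs))"
  have "N * (J * h)\<^sup>2 = N * (\<Sum>cs\<in>I. real (card (E cs)))\<^sup>2"
    using h by (simp add: J_def)
  also have "\<dots> \<le> N * (X * (\<Sum>cs\<in>I. \<Sum>ds\<in>I. real (card (E cs \<inter> E ds))))"
    unfolding X_def using Npos finI finE by (intro mult_left_mono card_UN_second_moment) auto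
  also have "\<dots> = X * (\<Sum>cs\<in>I. \<Sum>ds\<in>I. N * real (card (E cs \<inter> E ds)))"
    by (simp add: sum_distrib_left mult_ac)
  also have "\<dots> \<le> X * (\<Sum>cs\<in>I. \<Sum>ds\<in>I. 2 * real (card (agree m cs ds)) ^ s * h\<^sup>2)"
    by (intro mult_left_mono sum_mono pair) (auto simp: X_def)
  also have "\<dots> = X * 2 * h\<^sup>2 * (\<Sum>cs\<in>I. \<Sum>ds\<in>I. real (card (agree m cs ds)) ^ s)"
    by (simp add: sum_distrib_left mult_ac)
  also have "\<dots> \<le> X * 2 * h\<^sup>2 * (J\<^sup>2 * 3)"
    by (intro mult_left_mono agree_sum) (auto simp: X_def)
  finally have "N * (J * h)\<^sup>2 \<le> (6 * X) * (J * h)\<^sup>2"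
    by (simp add: power_mult_distrib mult_ac)
  moreover have "J > 0"
    by (simp add: J_def I_def card_column_lists)
  ultimately have "N \<le> 6 * X"
    using hpos by simp
  then show ?thesis
    by (simp add: N_def X_def I_def E_def S_def)
qed

section \<open>Choice of the parameters and conclusion\<close>

theorem theorem5p1:
  fixes C :: real
  assumes "C > 0"
  shows "\<exists>\<epsilon>>0. \<exists>\<delta>>0. \<forall>\<^sub>F n in sequentially.
    (let N = (2::real) ^ n in
      measure_pmf.prob (random_subset (F2_space n) (1/2))
        {A. \<exists>X \<subseteq> F2_space n.
              real (card X) \<ge> C * ln N * ln (ln N) \<and>
              real (card {(x1, x2) \<in> X \<times> X. x1 + x2 \<in> A}) \<ge> (1/2 + \<epsilon>) * (real (card X))\<^sup>2}
      \<ge> \<delta>)"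
proof -
  \<comment> \<open>The cap \<open>1/2\<close> ensures \<open>f \<le> 2 ^ k\<close>. The other bound
    makes \<open>f\<close> at most \<open>n * ln n / 16 + 1\<close>, whose main term is half of that
    in the lower bound for \<open>s * ln D\<close> when \<open>D > s\<close>.\<close>
  define \<epsilon> where "\<epsilon> = min (1/2) (1 / (64 * C))"
  have eps: "\<epsilon> > 0" "\<epsilon> \<le> 1/2" "\<epsilon> * C \<le> 1/64"
    using assms by (auto simp: \<epsilon>_def min_def field_simps)
  \<comment> \<open>The third fact will give \<open>3 * k + s \<le> n\<close>; the last two handle
    overlaps \<open>D > s\<close>.\<close>
  have ev: "\<forall>\<^sub>F n::nat in sequentially. n \<ge> 2"
    "\<forall>\<^sub>F n::nat in sequentially. 1 \<le> C * real n * ln (real n)"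
    "\<forall>\<^sub>F n::nat in sequentially. (2 * (C * real n * ln (real n))) ^ 3 * 2 powr (real n / 4) \<le> 2 powr real n"
    "\<forall>\<^sub>F n::nat in sequentially. sqrt (real n) \<le> real n / 4 - 1"
    "\<forall>\<^sub>F n::nat in sequentially. real n * ln (real n) / 16 + 1 \<le> (real n / 4 - 1) * (ln (real n) / 2)"
    using assms by real_asymp+
  show ?thesis
  proof (rule exI[of _ \<epsilon>], rule conjI[OF eps(1)], rule exI[of _ "1/6"], rule conjI)
    show "\<forall>\<^sub>F n in sequentially.
      (let N = (2::real) ^ n in
        measure_pmf.prob (random_subset (F2_space n) (1/2))
          {A. \<exists>X \<subseteq> F2_space n.
                real (card X) \<ge> C * ln N * ln (ln N) \<and>
                real (card {(x1, x2) \<in> X \<times> X. x1 + x2 \<in> A}) \<ge> (1/2 + \<epsilon>) * (real (card X))\<^sup>2}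
        \<ge> 1/6)"
      using ev
    proof eventually_elim
      case (elim n)
      define L where "L = C * real n * ln (real n)"
      \<comment> \<open>Replaces \<open>ln N = n * ln 2\<close> by \<open>n\<close>. Monotonicity of
        the product needs a nonnegative logarithm, hence \<open>n \<ge> 2\<close>.\<close>
      have "real n * ln 2 * ln (real n * ln 2) \<le> real n * ln (real n)"
      proof (rule mult_mono)
        have "1 \<le> real n * ln 2"
          using mult_mono[of 2 "real n" "1/2" "ln 2"] elim(1) ln2_ge_two_thirds by simp
        then show "0 \<le> ln (real n * ln 2)"
          by simp
        show "real n * ln 2 \<le> real n"
          using ln_2_less_1 by (simp add: mult_left_le)
        then show "ln (real n * ln 2) \<le> ln (real n)"
          using elim(1) by simp
      qed auto
      then have L_ge: "C * ln (2 ^ n) * ln (ln (2 ^ n)) \<le> L"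
        using assms by (simp add: L_def ln_realpow mult.assoc)
      have L1: "1 \<le> L"
        using elim(2) by (simp add: L_def)
      \<comment> \<open>Rounding up puts \<open>2 ^ k\<close> between \<open>L\<close> and
        \<open>2 * L\<close>: the lower bound makes the subspace large enough, the upper one
        controls \<open>f\<close> and \<open>3 * k + s\<close>.\<close>
      define k where "k = nat \<lceil>log 2 L\<rceil>"
      have log_L: "0 \<le> log 2 L"
        using L1 by simp
      have "L = 2 powr (log 2 L)"
        using L1 by simp
      also have "\<dots> \<le> 2 powr real k"
        using log_L by (intro powr_mono) (auto simp: k_def)
      finally have k_ge: "L \<le> 2 ^ k"
        by (simp add: powr_realpow)
      have "2 powr real k \<le> 2 powr (log 2 L + 1)"
        using log_L by (intro powr_mono) (auto simp: k_def)
      then have k_le: "2 ^ k \<le> 2 * L"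
        using L1 by (simp add: powr_realpow powr_add)
      \<comment> \<open>A constant fraction of \<open>n\<close>: small enough to leave room for
        \<open>3 * k\<close>, large enough for \<open>D ^ s\<close> to outweigh \<open>2 ^ f\<close>
        once \<open>D > s\<close>.\<close>
      define s where "s = n div 4"
      have s: "real n / 4 - 1 \<le> real s" "real s \<le> real n / 4"
        by (auto simp: s_def)
      have "(2::real) ^ (3 * k + s) = (2 ^ k) ^ 3 * 2 powr real s"
        by (simp add: power_add powr_realpow mult.commute flip: power_mult)
      also have "\<dots> \<le> (2 * L) ^ 3 * 2 powr (real n / 4)"
        using k_le s L1 by (intro mult_mono power_mono powr_mono) auto
      also have "\<dots> \<le> 2 ^ n"
        using elim(3) by (simp add: L_def powr_realpow)
      finally have size: "3 * k + s \<le> n"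
        by simp
      define m where "m = n - k"
      have n: "n = k + m"
        using size by (simp add: m_def)
      \<comment> \<open>The excess of \<open>2 * t\<close> over \<open>2 ^ k\<close>, rounded
        up.\<close>
      define f where "f = nat \<lceil>2 * \<epsilon> * 2 ^ k\<rceil>"
      define t where "t = (1/2 + \<epsilon>) * 2 ^ k"
      have f_ge: "2 * \<epsilon> * 2 ^ k \<le> real f"
        unfolding f_def by (rule real_nat_ceiling_ge)
      have f_le: "real f \<le> 2 * \<epsilon> * 2 ^ k + 1"
        using eps(1) by (simp add: f_def)
      have "2 * \<epsilon> * 2 ^ k \<le> (2::real) ^ k"
        using eps by simp
      then have f_bound: "f \<le> 2 ^ k"
        unfolding f_def by (simp add: nat_le_iff ceiling_le_iff)
      \<comment> \<open>The factor 2 is what \<open>D = 1\<close> requires; it also absorbs the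
        extra 1 in \<open>f + 1\<close>.\<close>
      have overlap: "min (2 ^ D) (2 ^ (f + 1)) \<le> 2 * real D ^ s" if D: "1 \<le> D" for D :: nat
      proof (cases "D = 1")
        case False
        then have D2: "2 \<le> D"
          using D by simp
        show ?thesis
        proof (cases "D \<le> s")
          case True
          then have "(2::real) ^ D \<le> 2 ^ s"
            by simp
          also have "\<dots> \<le> real D ^ s"
            using D2 by (intro power_mono) auto
          also have "\<dots> \<le> 2 * real D ^ s"
            by simp
          finally show ?thesis
            by (rule min.coboundedI1)
        next
          case False
          \<comment> \<open>Exceeding \<open>s\<close> puts \<open>D\<close> above
            \<open>sqrt n\<close>, so \<open>ln D\<close> is at least half of
            \<open>ln n\<close>.\<close>
          then have "sqrt (real n) \<le> real D"
            using elim(4) s by linarith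
          then have "ln (sqrt (real n)) \<le> ln (real D)"
            using elim(1) D by simp
          then have ln_D: "ln (real n) / 2 \<le> ln (real D)"
            using elim(1) by (simp add: ln_sqrt)
          have "\<epsilon> * 2 ^ k \<le> \<epsilon> * (2 * L)"
            using k_le eps by (intro mult_left_mono) auto
          also have "\<dots> = (\<epsilon> * C) * (2 * (real n * ln (real n)))"
            by (simp add: L_def)
          also have "\<dots> \<le> 1/64 * (2 * (real n * ln (real n)))"
            using eps elim(1) by (intro mult_right_mono) auto
          finally have "real f \<le> real n * ln (real n) / 16 + 1"
            using f_le by simp
          moreover have "real f * ln 2 \<le> real f"
            using ln_2_less_1 by (simp add: mult_left_le)
          ultimately have "real f * ln 2 \<le> (real n / 4 - 1) * (ln (real n) / 2)"
            using elim(5) by linarith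
          also have "\<dots> \<le> real s * ln (real D)"
            using s ln_D elim(1) by (intro mult_mono) auto
          finally have "ln (2 ^ f) \<le> ln (real D ^ s)"
            using D by (simp add: ln_realpow)
          then have "2 ^ f \<le> real D ^ s"
            using D by (subst (asm) ln_le_cancel_iff) auto
          then show ?thesis
            by (simp add: min.coboundedI2)
        qed
      qed auto
      let ?S = "F2_space n"
      let ?Ev = "{A. \<exists>X \<subseteq> ?S.
                real (card X) \<ge> C * ln (2 ^ n) * ln (ln (2 ^ n)) \<and>
                real (card {(x1, x2) \<in> X \<times> X. x1 + x2 \<in> A}) \<ge> (1/2 + \<epsilon>) * (real (card X))\<^sup>2}"
      \<comment> \<open>The witness \<open>X\<close> is the graph itself. \<open>?Ev\<close> also
        contains sets not inside \<open>?S\<close>, so it is cut down to the power set before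
        counting.\<close>
      have "(\<Union>cs\<in>column_lists m k. heavy ?S t (graph m cs)) \<subseteq> Pow ?S \<inter> ?Ev"
      proof clarify
        fix cs A assume cs: "cs \<in> column_lists m k" and "A \<in> heavy ?S t (graph m cs)"
        then have A: "A \<subseteq> ?S" "t \<le> real (card (A \<inter> graph m cs))"
          by (auto simp: heavy_def)
        have V: "graph m cs \<subseteq> ?S" "card (graph m cs) = 2 ^ k"
          using cs graph_subset card_graph by (auto simp: n)
        have "2 ^ k * t \<le> 2 ^ k * real (card (A \<inter> graph m cs))"
          using A by (intro mult_left_mono) auto
        also have "\<dots> = real (card {(x1, x2) \<in> graph m cs \<times> graph m cs. x1 + x2 \<in> A})"
          using card_sum_pairs_closed[OF V(1) graph_add_closed[OF cs], of A] V(2) by simp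
        finally have "(1/2 + \<epsilon>) * (real (card (graph m cs)))\<^sup>2
            \<le> real (card {(x1, x2) \<in> graph m cs \<times> graph m cs. x1 + x2 \<in> A})"
          using V(2) by (simp add: t_def power2_eq_square mult_ac)
        moreover have "C * ln (2 ^ n) * ln (ln (2 ^ n)) \<le> real (card (graph m cs))"
          using L_ge k_ge V(2) by simp
        ultimately show "A \<in> Pow ?S \<inter> ?Ev"
          using A V by blast
      qed
      then have "card (\<Union>cs\<in>column_lists m k. heavy ?S t (graph m cs)) \<le> card (Pow ?S \<inter> ?Ev)"
        by (intro card_mono) auto
      moreover have "2 ^ 2 ^ n \<le> 6 * real (card (\<Union>cs\<in>column_lists m k. heavy ?S t (graph m cs)))"
        unfolding n
      proof (rule card_heavy_graphs_ge)
        show "3 * k + s \<le> k + m"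
          using size n by simp
        show "2 * t \<le> 2 ^ k + real f"
          using f_ge by (simp add: t_def algebra_simps)
      qed (use f_bound overlap in auto)
      ultimately have "2 ^ 2 ^ n \<le> 6 * real (card (Pow ?S \<inter> ?Ev))"
        by linarith
      then have "1/6 \<le> real (card (Pow ?S \<inter> ?Ev)) / 2 ^ 2 ^ n"
        by (subst pos_le_divide_eq) auto
      \<comment> \<open>With inclusion probability \<open>1/2\<close> the random subset is uniform
        on the power set.\<close>
      moreover have "measure_pmf.prob (random_subset ?S (1/2)) ?Ev
          = real (card (Pow ?S \<inter> ?Ev)) / 2 ^ 2 ^ n"
        unfolding random_subset_def
        by (subst pmf_of_set_Pow_conv_bernoulli, simp, subst measure_pmf_of_set)
           (auto simp: card_Pow)
      ultimately show ?case
        unfolding Let_def by metis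
    qed
  qed simp
qed

end
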